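(* For every $r\in \mathbb{N}$ and every finite simple graph $G$, we have $\operatorname{cw}_r(G)\leq \operatorname{scol}_{4r}(G)$.
   Context: All graphs are finite, simple and undirected; $\mathbb{N}=\{1,2,\dots\}$ and $[a,b]=\{a,\dots,b\}$. For a graph $G$, a total order $\preceq$ of $V(G)$, a vertex $v$ and an integer $s\ge 1$, let $R(G,\preceq,v,s)$ be the set of vertices $w$ for which there is a path $v=w_0,w_1,\dots,w_{s'}=w$ of length $s'\in[0,s]$ with $w\preceq v$ and $v\prec w_i$ for all $i\in[s'-1]$. The $s$-strong colouring number $\operatorname{scol}_s(G)$ is the minimum, over all total orders $\preceq$ of $V(G)$, of $\max_{v\in V(G)}|R(G,\preceq,v,s)|$. Cop-width game with radius $r$ and width $k$ on $G$: initially the cops occupy a set $C_0\subseteq V(G)$ with $|C_0|\le k$ and the robber chooses a vertex $x_0$. In each round $i\ge1$, the cops announce a new set $C_i\subseteq V(G)$ with $|C_i|\le k$ (cops fly by helicopter, so $C_i$ is arbitrary); the robber, knowing $C_i$, then moves from $x_{i-1}$ to a vertex $x_i$ along a path in $G$ of length at most $r$ that contains no vertex of $C_{i-1}\cap C_i$ (the cops that stay on the ground). The robber is caught in round $i$ if $x_i\in C_i$. The radius-$r$ cop-width $\operatorname{cw}_r(G)$ is the least $k\in\mathbb{N}$ such that the cops have a strategy guaranteeing that the robber is caught after finitely many rounds. *)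

theory Defs
  imports "Graph_Theory.Graph_Theory"
begin

text \<open>A finite simple undirected graph is a \<^locale>\<open>graph\<close>, i.e. a finite loop-free symmetric
  digraph without parallel arcs. Paths are lists of distinct vertices (\<^const>\<open>vpath\<close>), whose
  length is the number of edges (\<^const>\<open>vwalk_length\<close>).\<close>

section \<open>Strong colouring numbers\<close>

text \<open>A total order of the vertices is a relation \<open>L\<close> on \<^term>\<open>verts G\<close>, where
  \<open>(x, y) \<in> L\<close> means that \<open>x\<close> precedes or equals \<open>y\<close>.\<close>

definition strong_reach ::
    "('a, 'b) pre_digraph \<Rightarrow> 'a rel \<Rightarrow> 'a \<Rightarrow> nat \<Rightarrow> 'a set" where
  "strong_reach G L v s =
     {w. \<exists>p. vpath p G \<and> hd p = v \<and> last p = w \<and> vwalk_length p \<le> s \<and> (w, v) \<in> L \<and>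
             (\<forall>i. 1 \<le> i \<and> i < vwalk_length p \<longrightarrow> (v, p ! i) \<in> L \<and> p ! i \<noteq> v)}"

definition scol :: "nat \<Rightarrow> ('a, 'b) pre_digraph \<Rightarrow> nat" where
  "scol s G =
     (MIN L\<in>{L. linear_order_on (verts G) L}. MAX v\<in>verts G. card (strong_reach G L v s))"

section \<open>Cop-width\<close>

text \<open>A strategy of the cops maps the list \<open>[x\<^sub>0, \<dots>, x\<^sub>i\<^sub>-\<^sub>1]\<close> of the past positions of the robber
  to the set \<open>C\<^sub>i\<close> of positions that the cops announce next; \<open>C\<^sub>0\<close> is its value at the
  empty list. The previous cop positions need not be recorded, since the strategy determines them.\<close>

definition cop_strategy ::
    "('a, 'b) pre_digraph \<Rightarrow> nat \<Rightarrow> ('a list \<Rightarrow> 'a set) \<Rightarrow> bool" where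
  "cop_strategy G k \<sigma> \<longleftrightarrow> (\<forall>h\<in>lists (verts G). \<sigma> h \<subseteq> verts G \<and> card (\<sigma> h) \<le> k)"

definition cop_positions :: "('a list \<Rightarrow> 'a set) \<Rightarrow> (nat \<Rightarrow> 'a) \<Rightarrow> nat \<Rightarrow> 'a set" where
  "cop_positions \<sigma> x i = \<sigma> (map x [0..<i])"

definition robber_move ::
    "('a, 'b) pre_digraph \<Rightarrow> nat \<Rightarrow> 'a set \<Rightarrow> 'a \<Rightarrow> 'a \<Rightarrow> bool" where
  "robber_move G r B u v \<longleftrightarrow>
     (\<exists>p. vpath p G \<and> hd p = u \<and> last p = v \<and> vwalk_length p \<le> r \<and> set p \<inter> B = {})"

definition robber_play ::
    "('a, 'b) pre_digraph \<Rightarrow> nat \<Rightarrow> ('a list \<Rightarrow> 'a set) \<Rightarrow> (nat \<Rightarrow> 'a) \<Rightarrow> bool" where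
  "robber_play G r \<sigma> x \<longleftrightarrow>
     x 0 \<in> verts G \<and>
     (\<forall>i\<ge>1. robber_move G r (cop_positions \<sigma> x (i - 1) \<inter> cop_positions \<sigma> x i) (x (i - 1)) (x i))"

text \<open>Plays are infinite sequences of moves; what happens after a capture is irrelevant.
  A robber who has not been caught and does not stand on a cop can always stay put, so he
  can only get stuck uncaught by choosing a start vertex \<open>x\<^sub>0 \<in> C\<^sub>0 \<inter> C\<^sub>1\<close>, and then he loses.
  This convention does not affect \<open>cop_width\<close>: the cops may start with \<open>C\<^sub>0 = {}\<close> and delay
  their strategy by one round.\<close>

definition cops_win :: "('a, 'b) pre_digraph \<Rightarrow> nat \<Rightarrow> nat \<Rightarrow> bool" where
  "cops_win G r k \<longleftrightarrow>
     (\<exists>\<sigma>. cop_strategy G k \<sigma> \<and>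
          (\<forall>x. robber_play G r \<sigma> x \<longrightarrow> (\<exists>i\<ge>1. x i \<in> cop_positions \<sigma> x i)))"

definition cop_width :: "nat \<Rightarrow> ('a, 'b) pre_digraph \<Rightarrow> nat" where
  "cop_width r G = (LEAST k. 1 \<le> k \<and> cops_win G r k)"

end

theory Submission
  imports Defs
begin

text \<open>Fix an optimal order. The cops keep a threshold \<open>u\<^sub>i\<close> below which the robber cannot go:
  \<open>u\<^sub>i\<^sub>+\<^sub>1\<close> is the least vertex of the ball of radius \<open>2r\<close> around the robber's position \<open>x\<^sub>i\<close>, taken in
  the subgraph of the vertices above \<open>u\<^sub>i\<close>, and the cops move to the set \<open>R(u\<^sub>i\<^sub>+\<^sub>1, 4r)\<close>. Suppose that the
  robber's path from \<open>x\<^sub>i\<close> meets a vertex not above \<open>u\<^sub>i\<close>, and let \<open>w\<close> be the first such vertex. Going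
  from \<open>u\<^sub>i\<^sub>+\<^sub>1\<close> to \<open>x\<^sub>i\<close> and then to \<open>w\<close> takes at most \<open>2r + r\<close> steps, and going from \<open>u\<^sub>i\<close> via
  \<open>x\<^sub>i\<^sub>-\<^sub>1\<close> and \<open>x\<^sub>i\<close> to \<open>w\<close> at most \<open>2r + r + r\<close>; by minimality neither walk goes below its start before
  \<open>w\<close>. Hence \<open>w\<close> is occupied by a cop who stays on the ground, a contradiction. So the robber stays
  above \<open>u\<^sub>i\<close>, and the strictly increasing thresholds eventually exhaust the graph.\<close>

section \<open>Balls in induced subgraphs\<close>

text \<open>Walks instead of paths let balls compose and reverse without removing repeated vertices.
  \<open>length\<close> counts vertices, so \<open>Suc n\<close> bounds \<open>n\<close> edges. The
  ball is empty when \<open>x\<close> is outside \<open>A\<close>.\<close>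

definition ball_in :: "('a, 'b) pre_digraph \<Rightarrow> 'a set \<Rightarrow> nat \<Rightarrow> 'a \<Rightarrow> 'a set" where
  "ball_in G A n x =
     {y. \<exists>p. vwalk p G \<and> hd p = x \<and> last p = y \<and> length p \<le> Suc n \<and> set p \<subseteq> A}"

lemma ball_inI:
  assumes "vwalk p G" and "hd p = x" and "last p = y" and "length p \<le> Suc n" and "set p \<subseteq> A"
  shows "y \<in> ball_in G A n x"
  using assms unfolding ball_in_def by blast

lemma ball_inE:
  assumes "y \<in> ball_in G A n x"
  obtains p where "vwalk p G" and "hd p = x" and "last p = y" and "length p \<le> Suc n" and "set p \<subseteq> A"
  using assms unfolding ball_in_def by blast

lemma ball_in_subset: "ball_in G A n x \<subseteq> A \<inter> verts G"
proof
  fix y assume "y \<in> ball_in G A n x"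
  then obtain p where "vwalk p G" "last p = y" "set p \<subseteq> A"
    by (rule ball_inE)
  then show "y \<in> A \<inter> verts G"
    by (auto simp: vwalk_def)
qed

lemma ball_in_refl:
  assumes "x \<in> A" and "x \<in> verts G"
  shows "x \<in> ball_in G A n x"
  using assms by (intro ball_inI[of "[x]"]) (auto simp: vwalk_def)

lemma ball_in_mono:
  assumes "m \<le> n" and "A \<subseteq> B"
  shows "ball_in G A m x \<subseteq> ball_in G B n x"
proof
  fix y assume "y \<in> ball_in G A m x"
  then obtain p where "vwalk p G" "hd p = x" "last p = y" "length p \<le> Suc m" "set p \<subseteq> A"
    by (rule ball_inE)
  with assms show "y \<in> ball_in G B n x"
    by (intro ball_inI[of p]) auto
qed

lemma ball_in_trans:
  assumes "y \<in> ball_in G A m x" and "z \<in> ball_in G A n y"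
  shows "z \<in> ball_in G A (m + n) x"
proof -
  obtain p where p: "vwalk p G" "hd p = x" "last p = y" "length p \<le> Suc m" "set p \<subseteq> A"
    using assms(1) by (rule ball_inE)
  obtain q where q: "vwalk q G" "hd q = y" "last q = z" "length q \<le> Suc n" "set q \<subseteq> A"
    using assms(2) by (rule ball_inE)
  have ne: "p \<noteq> []" "q \<noteq> []"
    using p(1) q(1) by auto
  then have j: "joinable p q"
    using p q by auto
  show ?thesis
  proof (rule ball_inI)
    show "vwalk (p \<oplus> q) G"
      using p(1) q(1) j by (rule vwalk_joinI_vwalk)
    show "hd (p \<oplus> q) = x" and "last (p \<oplus> q) = z"
      using j p q by (simp_all add: vwalk_join_hd vwalk_join_last)
    show "length (p \<oplus> q) \<le> Suc (m + n)"
      using p(4) q(4) ne by (cases q) (auto simp: vwalk_join_def)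
    show "set (p \<oplus> q) \<subseteq> A"
      using p(5) q(5) ne by (cases q) (auto simp: vwalk_join_def)
  qed
qed

lemma ball_in_sym:
  assumes "sym_digraph G" and "y \<in> ball_in G A n x"
  shows "x \<in> ball_in G A n y"
proof -
  obtain p where p: "vwalk p G" "hd p = x" "last p = y" "length p \<le> Suc n" "set p \<subseteq> A"
    using assms(2) by (rule ball_inE)
  have "sym (arcs_ends G)"
    using sym_digraph.sym_arcs[OF assms(1)] by (simp add: symmetric_def)
  then have "vwalk (rev p) G"
    using p(1) by (auto simp: vwalk_def set_vwalk_arcs_rev dest: symD)
  then show ?thesis
    using p by (intro ball_inI[of "rev p"]) (auto simp: hd_rev last_rev)
qed

lemma vwalk_set_subset_ball_in:
  assumes "vwalk p G" and "hd p = x" and "length p \<le> Suc n" and "set p \<subseteq> A"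
  shows "set p \<subseteq> ball_in G A n x"
proof
  fix y assume "y \<in> set p"
  then obtain ys zs where p: "p = (ys @ [y]) @ zs"
    by (auto dest: split_list)
  show "y \<in> ball_in G A n x"
  proof (rule ball_inI)
    show "vwalk (ys @ [y]) G"
      using assms(1) unfolding p by (rule vwalkI_append_l[rotated]) simp
    show "hd (ys @ [y]) = x"
      using assms(2) unfolding p by (cases ys) auto
  qed (use assms p in auto)
qed

text \<open>Every vertex on a witnessing walk lies in the ball itself, hence in \<open>B\<close>.
  This turns walks in a territory into walks above its least nearby vertex.\<close>

lemma ball_in_restrict:
  assumes "y \<in> ball_in G A n x" and "ball_in G A n x \<subseteq> B"
  shows "y \<in> ball_in G B n x"
proof -
  obtain p where p: "vwalk p G" "hd p = x" "last p = y" "length p \<le> Suc n" "set p \<subseteq> A"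
    using assms(1) by (rule ball_inE)
  then have "set p \<subseteq> B"
    using vwalk_set_subset_ball_in[of p G x n A] assms(2) by blast
  with p show ?thesis
    by (intro ball_inI)
qed

text \<open>Cut the walk just before its first vertex outside \<open>A\<close>: the part before the
  cut has at most \<open>n\<close> edges.\<close>

lemma vwalk_leaves_ball_in:
  assumes "vwalk p G" and "hd p = x" and "x \<in> A" and "length p \<le> Suc (Suc n)"
    and "\<not> set p \<subseteq> A"
  obtains z w where "z \<in> ball_in G A n x" and "(z, w) \<in> arcs_ends G" and "w \<in> set p" and "w \<notin> A"
proof -
  obtain ys w zs where p: "p = ys @ w # zs" and ys: "set ys \<subseteq> A" and w: "w \<notin> A"
    using assms(5) split_list_first_prop[of p "\<lambda>y. y \<notin> A"] by blast
  have ne: "ys \<noteq> []"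
    using assms(2,3) w p by auto
  have "vwalk ys G"
    using ne assms(1) unfolding p by (rule vwalkI_append_l)
  moreover have "hd ys = x"
    using assms(2) ne unfolding p by simp
  ultimately have "last ys \<in> ball_in G A n x"
    using ys assms(4) p by (intro ball_inI[of ys]) auto
  moreover have "(last ys, w) \<in> arcs_ends G"
    using assms(1) ne unfolding p by (auto simp: vwalk_def vwalk_arcs_append)
  ultimately show thesis
    using that w p by auto
qed

section \<open>Strong reachability\<close>

lemma length_vwalk_to_vpath_le: "length (vwalk_to_vpath p) \<le> length p"
proof (induction p rule: vwalk_to_vpath_induct3)
  case (in_set x xs)
  then show ?case
    using length_dropWhile_le[of "\<lambda>y. y \<noteq> x" xs] by auto
qed auto

locale ordered_graph = graph G for G :: "('a, 'b) pre_digraph" +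
  fixes L :: "'a rel"
  assumes linear_order: "linear_order_on (verts G) L"
begin

abbreviation at_least :: "'a \<Rightarrow> 'a set" where
  "at_least v \<equiv> {y. (v, y) \<in> L}"

definition above :: "'a \<Rightarrow> 'a set" where
  "above v = {y. (v, y) \<in> L \<and> y \<noteq> v}"

lemma L_subset: "L \<subseteq> verts G \<times> verts G"
  using linear_order by (simp add: order_on_defs)

lemma L_refl: "x \<in> verts G \<Longrightarrow> (x, x) \<in> L"
  using linear_order by (simp add: order_on_defs refl_on_def)

lemma L_trans: "(x, y) \<in> L \<Longrightarrow> (y, z) \<in> L \<Longrightarrow> (x, z) \<in> L"
  using linear_order by (meson order_on_defs transD)

lemma L_antisym: "(x, y) \<in> L \<Longrightarrow> (y, x) \<in> L \<Longrightarrow> x = y"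
  using linear_order by (meson order_on_defs antisymD)

lemma L_total: "x \<in> verts G \<Longrightarrow> y \<in> verts G \<Longrightarrow> (x, y) \<in> L \<or> (y, x) \<in> L"
  using linear_order L_refl by (cases "x = y") (auto simp: order_on_defs total_on_def)

lemma strong_reach_subset: "strong_reach G L v s \<subseteq> verts G"
  using L_subset by (auto simp: strong_reach_def)

lemma self_in_strong_reach:
  assumes "v \<in> verts G"
  shows "v \<in> strong_reach G L v s"
  unfolding strong_reach_def
  using assms by (auto intro!: exI[of _ "[v]"] vpath_self L_refl)

text \<open>Shortening the walk to a path keeps its ends \<open>v\<close> and \<open>w\<close>, and
  distinctness separates the inner vertices from both. So these come from the walk in the ball and
  lie strictly above \<open>v\<close>.\<close>

lemma strong_reachI:
  assumes z: "z \<in> ball_in G (at_least v) n v" and zw: "(z, w) \<in> arcs_ends G"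
    and wv: "(w, v) \<in> L" and s: "Suc n \<le> s"
  shows "w \<in> strong_reach G L v s"
proof (cases "w = v")
  case True
  then show ?thesis
    using self_in_strong_reach L_subset wv by auto
next
  case False
  obtain p where p: "vwalk p G" "hd p = v" "last p = z" "length p \<le> Suc n"
      "set p \<subseteq> at_least v"
    using z by (rule ball_inE)
  have p_ne: "p \<noteq> []"
    using p(1) by auto
  let ?p = "p @ [w]"
  let ?q = "vwalk_to_vpath ?p"
  have "vwalk ?p G"
    using p p_ne zw wv L_subset by (auto simp: vwalk_def set_vwalk_arcs_snoc)
  then have q: "vpath ?q G"
    by (rule vwalk_to_vpath_vpath)
  then have q_ne: "?q \<noteq> []" and dist: "distinct ?q"
    by (auto simp: vpath_def vwalk_def)
  have hd: "hd ?q = v" and last: "last ?q = w"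
    using p p_ne by (simp_all add: vwalk_to_vpath_hd vwalk_to_vpath_last)
  have len: "vwalk_length ?q \<le> s"
    using length_vwalk_to_vpath_le[of ?p] p(4) s by simp
  have "(v, ?q ! i) \<in> L \<and> ?q ! i \<noteq> v" if i: "1 \<le> i" "i < vwalk_length ?q" for i
  proof -
    have "?q ! i \<noteq> ?q ! 0" and "?q ! i \<noteq> ?q ! (length ?q - 1)"
      using i dist q_ne by (simp_all add: nth_eq_iff_index_eq)
    then have "?q ! i \<noteq> v" and "?q ! i \<noteq> w"
      using hd last q_ne by (simp_all add: hd_conv_nth last_conv_nth)
    moreover have "?q ! i \<in> set ?p"
      by (rule vwalk_to_vpath_subset[OF nth_mem]) (use i in simp)
    ultimately show ?thesis
      using p(5) by auto
  qed
  then show ?thesis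
    unfolding strong_reach_def using q hd last len wv by blast
qed

section \<open>The strategy of the cops\<close>

definition least_near :: "nat \<Rightarrow> 'a set \<Rightarrow> 'a \<Rightarrow> 'a" where
  "least_near r A x =
     (SOME u. u \<in> ball_in G A (2 * r) x \<and> (\<forall>y\<in>ball_in G A (2 * r) x. (u, y) \<in> L))"

lemma least_near:
  assumes "x \<in> A" and "x \<in> verts G"
  shows "least_near r A x \<in> ball_in G A (2 * r) x"
    and "\<And>y. y \<in> ball_in G A (2 * r) x \<Longrightarrow> (least_near r A x, y) \<in> L"
proof -
  have ex_least: "\<exists>u\<in>S. \<forall>y\<in>S. (u, y) \<in> L" if "finite S" "S \<noteq> {}" "S \<subseteq> verts G" for S
    using that
  proof (induction rule: finite_ne_induct)
    case (singleton x)
    then show ?case using L_refl by auto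
  next
    case (insert x F)
    then obtain u where u: "u \<in> F" "\<forall>y\<in>F. (u, y) \<in> L" by auto
    consider "(u, x) \<in> L" | "(x, u) \<in> L"
      using L_total u insert.prems by blast
    then show ?case
    proof cases
      case 1
      then show ?thesis using u by auto
    next
      case 2
      then show ?thesis
        using u insert.prems L_refl L_trans[OF 2] by (intro bexI[of _ x]) auto
    qed
  qed
  let ?B = "ball_in G A (2 * r) x"
  have "?B \<subseteq> verts G"
    using ball_in_subset[of G A "2 * r" x] by simp
  then have "\<exists>u. u \<in> ?B \<and> (\<forall>y\<in>?B. (u, y) \<in> L)"
    using ex_least[of ?B] ball_in_refl[OF assms, of "2 * r"] finite_subset[OF _ finite_verts, of ?B]
    by auto
  then have "least_near r A x \<in> ?B \<and> (\<forall>y\<in>?B. (least_near r A x, y) \<in> L)"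
    unfolding least_near_def by (rule someI_ex)
  then show "least_near r A x \<in> ?B" and "\<And>y. y \<in> ?B \<Longrightarrow> (least_near r A x, y) \<in> L"
    by auto
qed

text \<open>By minimality the ball of radius \<open>2 * r\<close> lies weakly above the threshold,
  and so does the walk from the threshold via \<open>x\<close> to \<open>z\<close>. With the arc to
  \<open>w\<close> it has at most 2r + n + 1 \<le> 4r edges.\<close>

lemma strong_reach_least_nearI:
  assumes x: "x \<in> A" "x \<in> verts G" and z: "z \<in> ball_in G A n x" and n: "n < 2 * r"
    and zw: "(z, w) \<in> arcs_ends G" and w: "(w, least_near r A x) \<in> L"
  shows "w \<in> strong_reach G L (least_near r A x) (4 * r)"
proof -
  let ?u = "least_near r A x"
  have sub: "ball_in G A (2 * r) x \<subseteq> at_least ?u"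
    using least_near(2)[OF x] by auto
  have "?u \<in> ball_in G (at_least ?u) (2 * r) x"
    using least_near(1)[OF x] sub by (rule ball_in_restrict)
  then have 1: "x \<in> ball_in G (at_least ?u) (2 * r) ?u"
    by (rule ball_in_sym[OF sym_digraph_axioms])
  have "ball_in G A n x \<subseteq> ball_in G A (2 * r) x"
    using n by (intro ball_in_mono) auto
  with sub have "z \<in> ball_in G (at_least ?u) n x"
    using ball_in_restrict[OF z] by auto
  with 1 have "z \<in> ball_in G (at_least ?u) (2 * r + n) ?u"
    by (rule ball_in_trans)
  then show ?thesis
    by (rule strong_reachI[OF _ zw w]) (use n in simp)
qed

text \<open>The region left to the robber. The fold recomputes all thresholds, because a strategy
  sees only the robber's positions.\<close>

definition territory :: "nat \<Rightarrow> 'a list \<Rightarrow> 'a set" where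
  "territory r h = foldl (\<lambda>A x. above (least_near r A x)) (verts G) h"

definition strategy :: "nat \<Rightarrow> 'a list \<Rightarrow> 'a set" where
  "strategy r h = (if h = [] then {}
     else strong_reach G L (least_near r (territory r (butlast h)) (last h)) (4 * r))"

lemma territory_snoc: "territory r (h @ [x]) = above (least_near r (territory r h) x)"
  by (simp add: territory_def)

lemma territory_subset: "territory r h \<subseteq> verts G"
  using L_subset by (cases h rule: rev_cases) (auto simp: territory_snoc above_def territory_def)

text \<open>This makes successive territories nested: if the new threshold lies in the territory, so
  does everything above it.\<close>

lemma territory_up_closed:
  assumes "x \<in> territory r h" and "(x, y) \<in> L"
  shows "y \<in> territory r h"
proof (cases h rule: rev_cases)
  case Nil
  then show ?thesis
    using assms(2) L_subset by (auto simp: territory_def)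
next
  case (snoc h' v)
  let ?u = "least_near r (territory r h') v"
  have x: "(?u, x) \<in> L" "x \<noteq> ?u"
    using assms(1) by (simp_all add: snoc territory_snoc above_def)
  then have "(?u, y) \<in> L" and "y \<noteq> ?u"
    using assms(2) L_trans[of ?u x y] L_antisym[of ?u x] by auto
  then show ?thesis
    by (simp add: snoc territory_snoc above_def)
qed

text \<open>All histories count, even those in which the robber has left the territory. There the
  ball is empty and \<open>least_near\<close> is an arbitrary value, possibly no vertex; its strong
  reach is then empty.\<close>

lemma cop_strategy_strategy:
  assumes "\<And>v. v \<in> verts G \<Longrightarrow> card (strong_reach G L v (4 * r)) \<le> k"
  shows "cop_strategy G k (strategy r)"
proof -
  have "card (strong_reach G L v (4 * r)) \<le> k" for v
  proof (cases "v \<in> verts G")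
    case False
    then have "(w, v) \<notin> L" for w
      using L_subset by blast
    then have "strong_reach G L v (4 * r) = {}"
      by (simp add: strong_reach_def)
    then show ?thesis by simp
  qed (rule assms)
  then show ?thesis
    using strong_reach_subset unfolding cop_strategy_def strategy_def by auto
qed

lemma strategy_catches:
  assumes r: "1 \<le> r" and play: "robber_play G r (strategy r) x"
  shows "\<exists>i\<ge>1. x i \<in> cop_positions (strategy r) x i"
proof (rule ccontr)
  assume free: "\<not> ?thesis"
  \<comment> \<open>The index is shifted: \<open>u i\<close>, computed from \<open>x i\<close>
    within \<open>A i\<close>, is the threshold \<open>u\<^sub>i\<^sub>+\<^sub>1\<close> of the
    overview, and \<open>C (Suc i)\<close> is the answer to it.\<close>
  define A where "A i = territory r (map x [0..<i])" for i
  define u where "u i = least_near r (A i) (x i)" for i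
  define C where "C i = cop_positions (strategy r) x i" for i
  have A_0: "A 0 = verts G" and A_Suc: "A (Suc i) = above (u i)" for i
    by (simp_all add: A_def u_def territory_snoc territory_def)
  have C_Suc: "C (Suc i) = strong_reach G L (u i) (4 * r)" for i
    by (simp add: C_def cop_positions_def strategy_def u_def A_def)
  have A_verts: "A i \<subseteq> verts G" for i
    unfolding A_def by (rule territory_subset)
  have u: "u i \<in> ball_in G (A i) (2 * r) (x i)"
      "\<And>y. y \<in> ball_in G (A i) (2 * r) (x i) \<Longrightarrow> (u i, y) \<in> L" if "x i \<in> A i" for i
    unfolding u_def using least_near that A_verts by blast+
  have u_A: "u i \<in> A i" if "x i \<in> A i" for i
    using u(1)[OF that] ball_in_subset[of G "A i"] by auto
  have A_dec: "A (Suc i) \<subset> A i" if "x i \<in> A i" for i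
    using u_A[OF that] territory_up_closed[of "u i" r "map x [0..<i]", folded A_def]
    unfolding A_Suc above_def by auto
  have caught: "w \<in> C (Suc i)"
    if "x i \<in> A i" "z \<in> ball_in G (A i) n (x i)" "n < 2 * r" "(z, w) \<in> arcs_ends G" "(w, u i) \<in> L"
    for i n z w
    using strong_reach_least_nearI[OF that(1) _ that(2-4)] that(1,5) A_verts
    unfolding C_Suc u_def by blast
  \<comment> \<open>The second conjunct serves the next induction step, which needs a walk from
    \<open>u i\<close> through \<open>x i\<close> to \<open>x (Suc i)\<close> inside
    \<open>A i\<close>.\<close>
  have inv: "x i \<in> A i \<and> x (Suc i) \<in> ball_in G (A i) r (x i)" for i
  proof (induction i)
    case 0
    have x0: "x 0 \<in> A 0"
      using play by (simp add: robber_play_def A_0)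
    have "robber_move G r (C 0 \<inter> C 1) (x 0) (x 1)"
      using play unfolding robber_play_def C_def by (metis diff_self_eq_0 le_refl)
    then obtain p where "vwalk p G" "hd p = x 0" "last p = x 1" "length p \<le> Suc r"
      unfolding robber_move_def by auto
    then have "x 1 \<in> ball_in G (A 0) r (x 0)"
      by (intro ball_inI) (auto simp: A_0 vwalk_def)
    with x0 show ?case by simp
  next
    case (Suc i)
    then have xi: "x i \<in> A i" and move: "x (Suc i) \<in> ball_in G (A i) r (x i)"
      by auto
    have "(u i, x (Suc i)) \<in> L"
      using u(2)[OF xi] move ball_in_mono[of r "2 * r" "A i" "A i" G "x i"] by auto
    \<comment> \<open>A cop stands on the threshold itself, so an uncaught robber is strictly above
      it.\<close>
    moreover have "u i \<in> C (Suc i)"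
      unfolding C_Suc using u_A[OF xi] A_verts by (intro self_in_strong_reach) auto
    then have "x (Suc i) \<noteq> u i"
      using spec[OF free[simplified], of "Suc i"] unfolding C_def by auto
    ultimately have x': "x (Suc i) \<in> A (Suc i)"
      by (simp add: A_Suc above_def)
    have "robber_move G r (C (Suc i) \<inter> C (Suc (Suc i))) (x (Suc i)) (x (Suc (Suc i)))"
      using play unfolding robber_play_def C_def by (metis diff_Suc_1 le_add1 plus_1_eq_Suc)
    then obtain p where p: "vwalk p G" "hd p = x (Suc i)" "last p = x (Suc (Suc i))"
        "length p \<le> Suc r" and avoid: "set p \<inter> (C (Suc i) \<inter> C (Suc (Suc i))) = {}"
      unfolding robber_move_def by auto
    have "set p \<subseteq> A (Suc i)"
    proof (rule ccontr)
      assume leave: "\<not> set p \<subseteq> A (Suc i)"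
      have "length p \<le> Suc (Suc (r - 1))"
        using p(4) r by simp
      then obtain z w where z: "z \<in> ball_in G (A (Suc i)) (r - 1) (x (Suc i))"
        and zw: "(z, w) \<in> arcs_ends G" and w: "w \<in> set p" "w \<notin> A (Suc i)"
        using vwalk_leaves_ball_in[OF p(1,2) x' _ leave] by blast
      have "w \<in> verts G" and "u i \<in> verts G"
        using w(1) p(1) u_A[OF xi] A_verts by auto
      then have wu: "(w, u i) \<in> L"
        using w(2) L_total L_refl unfolding A_Suc above_def by blast
      \<comment> \<open>Prepending the previous move gives radius \<open>r + (r - 1)\<close>, just
        below the bound \<open>2 * r\<close> in \<open>caught\<close>.\<close>
      have "z \<in> ball_in G (A i) (r - 1) (x (Suc i))"
        using z A_dec[OF xi] ball_in_mono[of "r - 1" "r - 1" "A (Suc i)" "A i"] by auto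
      with move have "z \<in> ball_in G (A i) (r + (r - 1)) (x i)"
        by (rule ball_in_trans)
      then have "w \<in> C (Suc i)"
        by (rule caught[OF xi _ _ zw wu]) (use r in simp)
      \<comment> \<open>The new threshold lies above the old one, so \<open>w\<close> precedes both
        and belongs to both cop sets.\<close>
      moreover have "(u i, u (Suc i)) \<in> L"
        using u_A[OF x'] by (simp add: A_Suc above_def)
      then have "(w, u (Suc i)) \<in> L"
        using wu by (rule L_trans[rotated])
      then have "w \<in> C (Suc (Suc i))"
        by (rule caught[OF x' z _ zw, rotated]) (use r in simp)
      ultimately show False
        using avoid w(1) by blast
    qed
    then have "x (Suc (Suc i)) \<in> ball_in G (A (Suc i)) r (x (Suc i))"
      using p by (intro ball_inI)
    with x' show ?case by simp
  qed
  have fin: "finite (A i)" for i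
    using A_verts by (rule finite_subset) simp
  \<comment> \<open>Each round removes a vertex from the territory, which is therefore empty after
    \<open>card (verts G)\<close> rounds.\<close>
  have "card (A i) + i \<le> card (verts G)" for i
  proof (induction i)
    case (Suc i)
    have "card (A (Suc i)) < card (A i)"
      using fin A_dec inv by (intro psubset_card_mono) auto
    with Suc show ?case by simp
  qed (simp add: A_0)
  from this[of "card (verts G)"] have "A (card (verts G)) = {}"
    using fin by simp
  then show False
    using inv by blast
qed

lemma cops_win_strong_reach:
  assumes "1 \<le> r" and "\<And>v. v \<in> verts G \<Longrightarrow> card (strong_reach G L v (4 * r)) \<le> k"
  shows "cops_win G r k"
  unfolding cops_win_def
  using cop_strategy_strategy[OF assms(2)] strategy_catches[OF assms(1)] by blast

end

section \<open>Optimal orders and the bound on cop-width\<close>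

lemma scol_attained:
  assumes "finite (verts G)"
  obtains L where "linear_order_on (verts G) L"
    and "scol s G = (MAX v\<in>verts G. card (strong_reach G L v s))"
proof -
  let ?S = "{L. linear_order_on (verts G) L}"
  have "?S \<subseteq> Pow (verts G \<times> verts G)"
    by (auto simp: order_on_defs)
  then have "finite ?S"
    using assms by (simp add: finite_subset)
  \<comment> \<open>The well-ordering theorem supplies a linear order.\<close>
  moreover have "?S \<noteq> {}"
    using well_order_on[of "verts G"] by (auto simp: well_order_on_def)
  ultimately have "scol s G \<in> (\<lambda>L. MAX v\<in>verts G. card (strong_reach G L v s)) ` ?S"
    unfolding scol_def by (intro Min_in) auto
  with that show thesis by auto
qed

theorem theorem3:
  fixes G :: "('a, 'b) pre_digraph" and r :: nat
  assumes "graph G" and "verts G \<noteq> {}" and "1 \<le> r"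
  shows "cop_width r G \<le> scol (4 * r) G"
proof -
  interpret graph G by (fact assms(1))
  obtain L where L: "linear_order_on (verts G) L"
    and scol: "scol (4 * r) G = (MAX v\<in>verts G. card (strong_reach G L v (4 * r)))"
    using scol_attained[OF finite_verts] by metis
  interpret ordered_graph G L by unfold_locales (fact L)
  have le: "card (strong_reach G L v (4 * r)) \<le> scol (4 * r) G" if "v \<in> verts G" for v
    unfolding scol using that by (intro Max_ge) auto
  obtain v where v: "v \<in> verts G"
    using assms(2) by blast
  \<comment> \<open>\<open>cop_width\<close> minimises over positive widths only; the bound is
    positive since \<open>v\<close> strongly reaches itself.\<close>
  have "finite (strong_reach G L v (4 * r))"
    using strong_reach_subset by (rule finite_subset) simp
  then have "1 \<le> card (strong_reach G L v (4 * r))"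
    using self_in_strong_reach[OF v, of "4 * r"] by (simp add: Suc_le_eq card_gt_0_iff) blast
  with le[OF v] have "1 \<le> scol (4 * r) G"
    by simp
  moreover have "cops_win G r (scol (4 * r) G)"
    using assms(3) le by (rule cops_win_strong_reach)
  ultimately show ?thesis
    unfolding cop_width_def by (intro Least_le conjI)
qed

end
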